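(* Let $\epsilon>0$, let $\mathcal{X}$ be a space of instances, let $X=\{x_i\}_{i=1}^n\in\mathcal{X}^n$ be a dataset of $n=|X|$ instances, and let $\phi:\mathcal{X}\to\mathbb{R}$. Put $\phi^{\min}=\min_{1\le i\le n}\phi(x_i)$ and $\phi^{\max}=\max_{1\le i\le n}\phi(x_i)$. Let $N\in\mathbb{N}$ and let $\tau=(\tau_1,\dots,\tau_N)$ be an ordered set of real points (the points on which one may want to evaluate the empirical cumulative distribution function of $\phi$), with $\tau_1=\phi^{\min}$ and $\tau_N=\phi^{\max}$. Let $L=\lceil\log_2 N\rceil$, and let $(\eta_{j,l})$, indexed by the pairs of integers $(j,l)$ with $0\le l\le L$ and $1\le j\le 2^{L-l}$, be independent random variables with $\eta_{j,l}\sim\mathrm{Lap}((L+1)/\epsilon)$. For $i\in\{1,\dots,N\}$ define $$F_\phi(X,\tau_i)=\frac1n\left|\{k\in\{1,\dots,n\}:\phi(x_k)\le\tau_i\}\right|,\qquad \hat F_\phi(X,\tau_i)=F_\phi(X,\tau_i)+\frac{1}{|X|}\sum_{l=0}^{L}\eta_{\lceil i/2^l\rceil,\,l}.$$ Then publishing $\hat F_\phi(X,\tau_i)$ for all $i\in\{1,\dots,N\}$ is $\epsilon$-differentially private. The expected squared error is $$\mathbb{E}\left[\left(F_\phi(x)-\hat F_\phi(x)\right)^2\right]=\frac{2(L+1)^3}{\epsilon^2},$$ where $F_\phi(x)$ and $\hat F_\phi(x)$ denote the values $F_\phi(X,\tau_i)$ and $\hat F_\phi(X,\tau_i)$ at an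 evaluation point $x=\tau_i$.
   Context: $\mathrm{Lap}(b)$ denotes the centered Laplace distribution with density $\frac{1}{2b}e^{-|u|/b}$ on $\mathbb{R}$ (variance $2b^2$). Two datasets $X^{(1)},X^{(2)}\in\mathcal{X}^*$ (finite datasets of instances from $\mathcal{X}$) are adjacent if they differ in only one element. An algorithm $\mathcal{A}$ taking datasets from $\mathcal{X}^*$ as input is $\epsilon$-differentially private if for every pair of adjacent datasets $X^{(1)},X^{(2)}$ and every subset $S$ of possible outputs of $\mathcal{A}$, $P(\mathcal{A}(X^{(1)})\in S)\le e^{\epsilon}P(\mathcal{A}(X^{(2)})\in S)$.
   Formalization: The expected squared error is proved as 2(L+1)^3/(n^2 ε^2); the stated value omits 1/n^2 and is false for n ≥ 2 (e.g. N=1, n=2, ε=1 gives 1/2, not 2). Privacy is read with τ fixed across datasets and adjacency as replacing one instance. *)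

theory Defs
  imports "HOL-Probability.Probability"
begin

definition laplace_density :: "real \<Rightarrow> real \<Rightarrow> real" where
  "laplace_density b u = exp (- \<bar>u\<bar> / b) / (2 * b)"

(* A dataset is a finite list of instances; "differ in only one element" is the
   replace-one relation, so adjacent datasets have the same size. *)
definition adjacent :: "'x list \<Rightarrow> 'x list \<Rightarrow> bool" where
  "adjacent X1 X2 \<longleftrightarrow>
     length X1 = length X2 \<and> card {k. k < length X1 \<and> X1 ! k \<noteq> X2 ! k} = 1"

(* A randomized algorithm is a family of random variables A X on the probability
   space M with values in the measurable space Q.  The first conjunct rules out
   the junk value 0 that measure assigns to non-measurable sets. *)
definition differentially_private ::
    "'w measure \<Rightarrow> 'o measure \<Rightarrow> real \<Rightarrow> ('x list \<Rightarrow> 'w \<Rightarrow> 'o) \<Rightarrow> bool" where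
  "differentially_private M Q \<epsilon> A \<longleftrightarrow>
     (\<forall>X. A X \<in> measurable M Q) \<and>
     (\<forall>X1 X2. adjacent X1 X2 \<longrightarrow>
        (\<forall>S\<in>sets Q. measure M {w \<in> space M. A X1 w \<in> S}
                      \<le> exp \<epsilon> * measure M {w \<in> space M. A X2 w \<in> S}))"

definition empirical_cdf :: "('x \<Rightarrow> real) \<Rightarrow> 'x list \<Rightarrow> real \<Rightarrow> real" where
  "empirical_cdf \<phi> X t = real (card {k. k < length X \<and> \<phi> (X ! k) \<le> t}) / real (length X)"

definition noise_index :: "nat \<Rightarrow> (nat \<times> nat) set" where
  "noise_index L = {(j, l). l \<le> L \<and> 1 \<le> j \<and> j \<le> 2 ^ (L - l)}"

definition noisy_cdf ::
    "('x \<Rightarrow> real) \<Rightarrow> (nat \<Rightarrow> real) \<Rightarrow> nat \<Rightarrow> (nat \<times> nat \<Rightarrow> 'w \<Rightarrow> real) \<Rightarrow> 'x list \<Rightarrow> nat \<Rightarrow> 'w \<Rightarrow> real" where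
  "noisy_cdf \<phi> \<tau> L \<eta> X i w =
     empirical_cdf \<phi> X (\<tau> i)
     + 1 / real (length X) * (\<Sum>l=0..L. \<eta> (nat \<lceil>real i / 2 ^ l\<rceil>, l) w)"

end

(* Replacing one instance changes the counts at tau_1, ..., tau_N by the indicator of {i. i <= q} minus
   that of {i. i <= p}. A change of the noise by node weights whose sums along the leaf-to-root
   paths give this difference turns one output into the other, and costs a factor exp (|s| / b) for
   every weight s. Give each dyadic block the value 1 or 0 if the indicator is constantly so on it,
   and 1/2 if it is not constant, and let the weight of a node be its value minus that of its parent.
   Outside the root, one prefix costs at most (L + 1) / 2; if both prefixes cut the root block, the
   two root weights cancel. Hence the total cost is at most L + 1, which is exactly what noise of
   scale (L + 1) / epsilon pays for. (The usual dyadic decomposition with 0/1 weights needs up to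
   about 2 L nodes.) *)
theory Submission
  imports Defs
begin

section \<open>The Laplace distribution\<close>

lemma laplace_density_nonneg: "0 < b \<Longrightarrow> 0 \<le> laplace_density b u"
  by (simp add: laplace_density_def)

lemma laplace_density_measurable [measurable]: "laplace_density b \<in> borel_measurable borel"
  unfolding laplace_density_def by measurable

lemma laplace_density_shift_le:
  assumes "0 < b"
  shows "laplace_density b (x - s) \<le> exp (\<bar>s\<bar> / b) * laplace_density b x"
proof -
  have "- \<bar>x - s\<bar> / b \<le> (\<bar>s\<bar> - \<bar>x\<bar>) / b"
    using assms by (intro divide_right_mono) auto
  then have "exp (- \<bar>x - s\<bar> / b) \<le> exp (\<bar>s\<bar> / b) * exp (- \<bar>x\<bar> / b)"
    by (simp flip: exp_add add: diff_divide_distrib)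
  then show ?thesis
    using assms by (simp add: laplace_density_def divide_right_mono)
qed

text \<open>Substitution moves the shift from \<open>f\<close> into the density, where the pointwise
  ratio bound applies. The form for functions instead of sets is what the induction over coordinates
  below consumes.\<close>

lemma nn_integral_laplace_shift_le:
  fixes f :: "real \<Rightarrow> ennreal"
  assumes "0 < b" and [measurable]: "f \<in> borel_measurable borel"
  shows "(\<integral>\<^sup>+x. f (x + s) \<partial>density lborel (laplace_density b))
       \<le> ennreal (exp (\<bar>s\<bar> / b)) * (\<integral>\<^sup>+x. f x \<partial>density lborel (laplace_density b))"
proof -
  have "(\<integral>\<^sup>+x. f (x + s) \<partial>density lborel (laplace_density b))
      = (\<integral>\<^sup>+x. ennreal (laplace_density b x) * f (x + s) \<partial>lborel)"
    by (simp add: nn_integral_density)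
  also have "\<dots> = (\<integral>\<^sup>+x. ennreal (laplace_density b (x - s)) * f x \<partial>lborel)"
    by (subst nn_integral_real_affine[where c = 1 and t = "-s"]) auto
  also have "\<dots> \<le> (\<integral>\<^sup>+x. ennreal (exp (\<bar>s\<bar> / b)) * (ennreal (laplace_density b x) * f x) \<partial>lborel)"
    using laplace_density_shift_le[OF \<open>0 < b\<close>] \<open>0 < b\<close>
    by (intro nn_integral_mono)
       (auto simp flip: mult.assoc ennreal_mult intro!: mult_right_mono ennreal_leI
             simp: laplace_density_nonneg)
  also have "\<dots> = ennreal (exp (\<bar>s\<bar> / b)) * (\<integral>\<^sup>+x. f x \<partial>density lborel (laplace_density b))"
    by (simp add: nn_integral_density nn_integral_cmult)
  finally show ?thesis .
qed

text \<open>Fubini and induction over the coordinates: shifting coordinate \<open>i\<close> with the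
  others held fixed costs the factor \<open>c i\<close>, so the factors multiply.\<close>

lemma nn_integral_PiM_shift_le:
  fixes M :: "'i \<Rightarrow> real measure" and f :: "('i \<Rightarrow> real) \<Rightarrow> ennreal" and s :: "'i \<Rightarrow> real" and c :: "'i \<Rightarrow> ennreal"
  assumes "product_sigma_finite M" and "finite I"
    and sets_M [measurable_cong]: "\<And>i. sets (M i) = sets borel"
    and shift: "\<And>i g. i \<in> I \<Longrightarrow> g \<in> borel_measurable borel \<Longrightarrow>
      (\<integral>\<^sup>+x. g (x + s i) \<partial>M i) \<le> c i * (\<integral>\<^sup>+x. g x \<partial>M i)"
    and "f \<in> borel_measurable (Pi\<^sub>M I M)"
  shows "(\<integral>\<^sup>+h. f (\<lambda>i\<in>I. h i + s i) \<partial>Pi\<^sub>M I M) \<le> (\<Prod>i\<in>I. c i) * (\<integral>\<^sup>+h. f h \<partial>Pi\<^sub>M I M)"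
proof -
  interpret product_sigma_finite M by fact
  show ?thesis
    using assms(2,4,5)
  proof (induction I arbitrary: f rule: finite_induct)
    case empty
    have "(\<lambda>i\<in>{}. h i + s i) = (\<lambda>_. undefined)" for h
      by auto
    then show ?case
      by (simp add: PiM_empty nn_integral_count_space_finite)
  next
    case (insert i I)
    note [measurable] = \<open>f \<in> borel_measurable (Pi\<^sub>M (insert i I) M)\<close>
    let ?T = "\<lambda>J h. \<lambda>j\<in>J. h j + s j"
    have upd: "(?T (insert i I) (h(i := x))) = (?T I h)(i := x + s i)" for h x
      using insert.hyps by (auto simp: fun_eq_iff restrict_def)
    have T [measurable]: "?T J \<in> measurable (Pi\<^sub>M J M) (Pi\<^sub>M J M)" for J
      by measurable
    have sec [measurable]: "(\<lambda>x. f (h(i := x))) \<in> borel_measurable borel" if "h \<in> space (Pi\<^sub>M I M)" for h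
    proof -
      have "(\<lambda>x. f (h(i := x))) \<in> borel_measurable (M i)"
        using that by measurable
      then show ?thesis
        by (simp cong: measurable_cong_sets add: sets_M)
    qed
    have [measurable]: "(\<lambda>(h, x). f (h(i := x))) \<in> borel_measurable (Pi\<^sub>M I M \<Otimes>\<^sub>M M i)"
      using measurable_comp[OF measurable_add_dim insert.prems(2)]
      by (simp add: comp_def split_def)
    interpret I: sigma_finite_measure "M i" by (rule sigma_finite_measures)
    have inner: "(\<lambda>h. \<integral>\<^sup>+x. f (h(i := x)) \<partial>M i) \<in> borel_measurable (Pi\<^sub>M I M)"
      by measurable
    have "(\<integral>\<^sup>+h. f (?T (insert i I) h) \<partial>Pi\<^sub>M (insert i I) M)
        = (\<integral>\<^sup>+h. (\<integral>\<^sup>+x. f ((?T I h)(i := x + s i)) \<partial>M i) \<partial>Pi\<^sub>M I M)"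
      unfolding upd [symmetric] using insert.hyps by (intro product_nn_integral_insert) auto
    also have "\<dots> \<le> (\<integral>\<^sup>+h. c i * (\<integral>\<^sup>+x. f ((?T I h)(i := x)) \<partial>M i) \<partial>Pi\<^sub>M I M)"
    proof (intro nn_integral_mono)
      fix h assume h: "h \<in> space (Pi\<^sub>M I M)"
      then have "?T I h \<in> space (Pi\<^sub>M I M)"
        using measurable_space[of "?T I" "Pi\<^sub>M I M" "Pi\<^sub>M I M"] by simp
      from insert.prems(1)[OF insertI1 sec[OF this]]
      show "(\<integral>\<^sup>+x. f ((?T I h)(i := x + s i)) \<partial>M i) \<le> c i * (\<integral>\<^sup>+x. f ((?T I h)(i := x)) \<partial>M i)"
        by simp
    qed
    also have "\<dots> = c i * (\<integral>\<^sup>+h. (\<integral>\<^sup>+x. f ((?T I h)(i := x)) \<partial>M i) \<partial>Pi\<^sub>M I M)"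
      by (rule nn_integral_cmult[OF measurable_compose[OF T inner]])
    \<comment> \<open>The induction hypothesis is applied to the inner integral as a function of
      \<open>h\<close>, not to \<open>f\<close>; hence the generalization over
      \<open>f\<close>.\<close>
    also have "\<dots> \<le> c i * ((\<Prod>i\<in>I. c i) * (\<integral>\<^sup>+h. (\<integral>\<^sup>+x. f (h(i := x)) \<partial>M i) \<partial>Pi\<^sub>M I M))"
      by (intro mult_left_mono insert.IH[OF _ inner] insert.prems(1)) auto
    also have "\<dots> = (\<Prod>i\<in>insert i I. c i) * (\<integral>\<^sup>+h. f h \<partial>Pi\<^sub>M (insert i I) M)"
      using insert.hyps by (subst product_nn_integral_insert) (auto simp: mult.assoc)
    finally show ?case .
  qed
qed

section \<open>Moments of Laplace noise and of sums of independent noise\<close>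

text \<open>On the half-line the Laplace density is half the exponential density of rate
  \<open>1/b\<close>, whose moments are those of the Erlang distribution of shape 0.\<close>

lemma has_bochner_integral_laplace_moment_half:
  assumes "0 < b"
  shows "has_bochner_integral lborel
    (\<lambda>x. indicator {0..} x *\<^sub>R (laplace_density b x * x ^ i)) (fact i * b ^ i / 2)"
proof (rule has_bochner_integral_nn_integral)
  have "(\<integral>\<^sup>+x. ennreal (indicator {0..} x *\<^sub>R (laplace_density b x * x ^ i)) \<partial>lborel)
      = (\<integral>\<^sup>+x. ennreal (1/2) * ennreal (exponential_density (1/b) x * x ^ i) \<partial>lborel)"
  proof (intro nn_integral_cong)
    fix x :: real
    have "indicator {0..} x *\<^sub>R (laplace_density b x * x ^ i)
        = 1/2 * (exponential_density (1/b) x * x ^ i)"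
      using assms by (simp add: laplace_density_def exponential_density_def indicator_def)
    then show "ennreal (indicator {0..} x *\<^sub>R (laplace_density b x * x ^ i))
        = ennreal (1/2) * ennreal (exponential_density (1/b) x * x ^ i)"
      by (simp only: ennreal_mult' [symmetric] ennreal_mult [symmetric])
  qed
  also have "\<dots> = ennreal (1/2) * ennreal (fact i * b ^ i)"
    using assms nn_integral_erlang_ith_moment[of "1/b" 0 i]
    by (subst nn_integral_cmult) (auto simp: power_divide)
  also have "\<dots> = ennreal (fact i * b ^ i / 2)"
    by (simp only: ennreal_mult' [symmetric]) simp
  finally show "(\<integral>\<^sup>+x. ennreal (indicator {0..} x *\<^sub>R (laplace_density b x * x ^ i)) \<partial>lborel)
      = ennreal (fact i * b ^ i / 2)" .
qed (use assms in \<open>auto simp: laplace_density_nonneg indicator_def\<close>)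

text \<open>By symmetry of the density, the half-line integral cancels for the odd power and doubles
  for the even one.\<close>

lemma has_bochner_integral_laplace_moments:
  assumes "0 < b"
  shows "has_bochner_integral lborel (\<lambda>x. laplace_density b x * x) 0"
    and "has_bochner_integral lborel (\<lambda>x. laplace_density b x * x\<^sup>2) (2 * b\<^sup>2)"
  using has_bochner_integral_odd_function[OF has_bochner_integral_laplace_moment_half[OF assms, of 1]]
    has_bochner_integral_even_function[OF has_bochner_integral_laplace_moment_half[OF assms, of 2]]
  by (simp_all add: laplace_density_def numeral_2_eq_2)

lemma (in prob_space) laplace_distributed_moments:
  assumes "0 < b" and D: "distributed M lborel X (\<lambda>u. ennreal (laplace_density b u))"
  shows "integrable M X" and "expectation X = 0"
    and "integrable M (\<lambda>w. (X w)\<^sup>2)" and "expectation (\<lambda>w. (X w)\<^sup>2) = 2 * b\<^sup>2"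
  using has_bochner_integral_laplace_moments[OF \<open>0 < b\<close>]
    distributed_integrable[OF D, of "\<lambda>x. x"] distributed_integrable[OF D, of power2]
    distributed_integral[OF D, of "\<lambda>x. x"] distributed_integral[OF D, of power2]
  by (auto simp: has_bochner_integral_iff laplace_density_nonneg[OF \<open>0 < b\<close>])

text \<open>The cross terms vanish, as independent centered variables have a product of mean 0.
  Integrability is part of the induction because splitting the expectation of the expanded square
  needs it.\<close>

lemma (in prob_space) indep_vars_sum_second_moment:
  fixes X :: "'i \<Rightarrow> 'a \<Rightarrow> real"
  assumes "finite I" and "indep_vars (\<lambda>_. borel) X I"
    and "\<And>i. i \<in> I \<Longrightarrow> integrable M (X i)" and "\<And>i. i \<in> I \<Longrightarrow> expectation (X i) = 0"
    and "\<And>i. i \<in> I \<Longrightarrow> integrable M (\<lambda>w. (X i w)\<^sup>2)"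
  shows "integrable M (\<lambda>w. (\<Sum>i\<in>I. X i w)\<^sup>2) \<and>
    expectation (\<lambda>w. (\<Sum>i\<in>I. X i w)\<^sup>2) = (\<Sum>i\<in>I. expectation (\<lambda>w. (X i w)\<^sup>2))"
  using assms
proof (induction I rule: finite_induct)
  case (insert i I)
  let ?S = "\<lambda>w. \<Sum>i\<in>I. X i w"
  have IH: "integrable M (\<lambda>w. (?S w)\<^sup>2)"
    "expectation (\<lambda>w. (?S w)\<^sup>2) = (\<Sum>i\<in>I. expectation (\<lambda>w. (X i w)\<^sup>2))"
    using insert.IH insert.prems indep_vars_subset[OF insert.prems(1)] by auto
  have indep: "indep_var borel (X i) borel ?S"
    using insert.hyps insert.prems(1) by (rule indep_vars_sum)
  have S: "integrable M ?S"
    using insert.prems by auto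
  have cross: "integrable M (\<lambda>w. X i w * ?S w)" "expectation (\<lambda>w. X i w * ?S w) = 0"
    using indep_var_integrable[OF indep _ S] indep_var_lebesgue_integral[OF indep _ S] insert.prems
    by auto
  have "(\<lambda>w. (\<Sum>i\<in>insert i I. X i w)\<^sup>2) = (\<lambda>w. (X i w)\<^sup>2 + 2 * (X i w * ?S w) + (?S w)\<^sup>2)"
    using insert.hyps by (simp add: fun_eq_iff power2_sum algebra_simps)
  then show ?case
    using IH cross insert.prems insert.hyps by simp
qed simp

section \<open>Weights on the dyadic tree\<close>

lemma nat_ceiling_div_pow2: "nat \<lceil>real i / 2 ^ l\<rceil> = (if i = 0 then 0 else Suc ((i - 1) div 2 ^ l))"
proof -
  have "\<lceil>real i / 2 ^ l\<rceil> = int (Suc ((i - 1) div 2 ^ l))" if "i \<noteq> 0"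
  proof -
    define q where "q = (i - 1) div 2 ^ l"
    \<comment> \<open>Leaves are numbered from 1, so the division is of \<open>i - 1\<close>.
      Returning to \<open>i\<close> makes the lower bound strict and the upper one weak, as a
      ceiling requires.\<close>
    have "q * 2 ^ l \<le> i - 1" "i - 1 < Suc q * 2 ^ l"
      unfolding q_def by (simp, metis dividend_less_div_times mult.commute mult_Suc zero_less_numeral zero_less_power)
    then have "q * 2 ^ l < i" "i \<le> Suc q * 2 ^ l"
      using that by auto
    then have "real q * 2 ^ l < real i" "real i \<le> real (Suc q) * 2 ^ l"
      by (simp_all only: of_nat_less_iff [where 'a = real, symmetric] of_nat_le_iff [where 'a = real, symmetric]
            of_nat_mult of_nat_power of_nat_numeral)
    then show ?thesis
      unfolding q_def [symmetric] by (intro ceiling_unique) (auto simp: field_simps)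
  qed
  then show ?thesis
    by auto
qed

lemma dyadic_in_noise_index:
  assumes "i \<in> {1..2 ^ L}" "l \<le> L"
  shows "(Suc ((i - 1) div 2 ^ l), l) \<in> noise_index L"
proof -
  have "i - 1 < 2 ^ (L - l) * 2 ^ l"
    using assms by (simp flip: power_add) auto
  then have "(i - 1) div 2 ^ l < 2 ^ (L - l)"
    by (simp add: less_mult_imp_div_less)
  then show ?thesis
    using assms by (simp add: noise_index_def Suc_le_eq)
qed

lemma noise_index_eq: "noise_index L = (SIGMA l:{0..L}. {1..2 ^ (L - l)})\<inverse>"
  by (auto simp: noise_index_def)

lemma finite_noise_index: "finite (noise_index L)"
  by (simp add: noise_index_eq)

lemma sum_noise_index:
  "(\<Sum>p\<in>noise_index L. f p) = (\<Sum>l=0..L. \<Sum>j=1..2 ^ (L - l). f (j, l))"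
proof -
  have "(\<Sum>p\<in>noise_index L. f p) = (\<Sum>(l, j)\<in>(SIGMA l:{0..L}. {1..2 ^ (L - l)}). f (j, l))"
    by (rule sum.reindex_bij_witness[where i = prod.swap and j = prod.swap])
       (auto simp: noise_index_def)
  then show ?thesis
    by (simp add: sum.Sigma)
qed

text \<open>Node \<open>(j, l)\<close> of the tree is the block \<open>{(j - 1) * 2 ^ l + 1..j * 2 ^ l}\<close> of leaves;
  it is cut by the prefix \<open>{1..k}\<close> iff \<open>j = Suc (k div 2 ^ l)\<close> and \<open>2 ^ l\<close> does not divide \<open>k\<close>.\<close>
definition block_value :: "nat \<Rightarrow> nat \<Rightarrow> nat \<Rightarrow> real" where
  "block_value k l j =
     (if j \<le> k div 2 ^ l then 1 else if j = Suc (k div 2 ^ l) \<and> \<not> 2 ^ l dvd k then 1/2 else 0)"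

text \<open>The root has no parent and keeps its full value, so that weights along a leaf-to-root
  path telescope to the value at the leaf.\<close>

definition node_weight :: "nat \<Rightarrow> nat \<Rightarrow> nat \<times> nat \<Rightarrow> real" where
  "node_weight L k = (\<lambda>(j, l).
     block_value k l j - (if l < L then block_value k (Suc l) (Suc ((j - 1) div 2)) else 0))"

text \<open>The parent of the level-\<open>l\<close> block containing leaf \<open>i\<close> is the
  level-\<open>Suc l\<close> block containing it, so the sum telescopes. A single leaf is never cut,
  since 1 divides \<open>k\<close>; its value is 0 or 1.\<close>

lemma sum_node_weight:
  assumes "i \<noteq> 0"
  shows "(\<Sum>l=0..L. node_weight L k (Suc ((i - 1) div 2 ^ l), l)) = of_bool (i \<le> k)"
proof -
  let ?g = "\<lambda>l. block_value k l (Suc ((i - 1) div 2 ^ l))"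
  have "(\<Sum>l=0..L. node_weight L k (Suc ((i - 1) div 2 ^ l), l))
      = (\<Sum>l<L. ?g l - ?g (Suc l)) + ?g L"
    by (simp add: node_weight_def atLeast0AtMost lessThan_Suc_atMost[symmetric] div_mult2_eq power_Suc2
          del: power_Suc)
  also have "\<dots> = ?g 0"
    using sum_lessThan_telescope'[of ?g L] by simp
  also have "\<dots> = of_bool (i \<le> k)"
    using assms by (simp add: block_value_def)
  finally show ?thesis .
qed

text \<open>Only the two children of a cut block have nonzero weight. If \<open>k\<close> falls
  exactly between them, they cost 1/2 each; if one child is cut too, it has the value of its parent
  and costs nothing, and the other costs 1/2.\<close>

lemma level_sum_node_weight_le:
  assumes "l < L" "finite J" "0 \<notin> J"
  shows "(\<Sum>j\<in>J. \<bar>node_weight L k (j, l)\<bar>)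
    \<le> of_bool (\<not> 2 ^ Suc l dvd k) - of_bool (\<not> 2 ^ l dvd k) / 2"
proof -
  define c where "c = k div 2 ^ l"
  have half: "k div 2 ^ Suc l = c div 2"
    by (simp add: c_def div_mult2_eq power_Suc2 del: power_Suc)
  have dvd_Suc: "2 ^ Suc l dvd k \<longleftrightarrow> 2 ^ l dvd k \<and> even c"
  proof
    assume "2 ^ Suc l dvd k"
    then obtain m where "k = 2 ^ l * (2 * m)"
      unfolding dvd_def by (metis mult.assoc power_Suc2)
    then show "2 ^ l dvd k \<and> even c"
      by (simp add: c_def)
  next
    assume "2 ^ l dvd k \<and> even c"
    then obtain m where "k = 2 ^ l * c" "c = 2 * m"
      by (auto simp: c_def)
    then show "2 ^ Suc l dvd k"
      by simp
  qed
  \<comment> \<open>Under a cut parent, the left child costs 1/2 iff it lies inside the prefix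
    (\<open>odd c\<close>), the right child iff it is disjoint from the prefix
    (\<open>even c\<close>, or the cut falls between the children).\<close>
  define a b :: real
    where "a = of_bool (\<not> 2 ^ Suc l dvd k \<and> odd c) / 2"
      and "b = of_bool (\<not> 2 ^ Suc l dvd k \<and> (even c \<or> 2 ^ l dvd k)) / 2"
  have "\<bar>node_weight L k (j, l)\<bar>
      \<le> (if j = 2 * (c div 2) + 1 then a else 0) + (if j = 2 * (c div 2) + 2 then b else 0)"
    if "j \<noteq> 0" for j
  proof -
    define m where "m = (j - 1) div 2"
    have m: "j = 2 * m + 1 \<or> j = 2 * m + 2"
      using that unfolding m_def by presburger
    have bv: "block_value k l j =
        (if j \<le> c then 1 else if j = Suc c \<and> \<not> 2 ^ l dvd k then 1/2 else 0)"
      by (simp add: block_value_def c_def)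
    have nw: "node_weight L k (j, l) = block_value k l j -
        (if m < c div 2 then 1 else if m = c div 2 \<and> \<not> 2 ^ Suc l dvd k then 1/2 else 0)"
      using m \<open>l < L\<close> by (auto simp: node_weight_def block_value_def half simp del: power_Suc)
    show ?thesis
    proof (cases "even c")
      case True
      then obtain e where "c = 2 * e" ..
      with m show ?thesis
        unfolding nw bv a_def b_def dvd_Suc by auto
    next
      case False
      then obtain e where "c = 2 * e + 1" ..
      with m show ?thesis
        unfolding nw bv a_def b_def dvd_Suc by auto
    qed
  qed
  then have "(\<Sum>j\<in>J. \<bar>node_weight L k (j, l)\<bar>)
      \<le> (\<Sum>j\<in>J. (if j = 2 * (c div 2) + 1 then a else 0) + (if j = 2 * (c div 2) + 2 then b else 0))"
    using \<open>0 \<notin> J\<close> by (intro sum_mono) metis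
  also have "\<dots> \<le> a + b"
    using \<open>finite J\<close> by (simp add: sum.distrib a_def b_def)
  also have "\<dots> \<le> of_bool (\<not> 2 ^ Suc l dvd k) - of_bool (\<not> 2 ^ l dvd k) / 2"
    unfolding a_def b_def dvd_Suc by auto
  finally show ?thesis .
qed

text \<open>If a block is cut, so are its ancestors. Summing the level bounds, each level strictly
  between 0 and \<open>L\<close> counts 1 - 1/2 and level \<open>L\<close> counts 1, which gives at
  most 1 + (\<open>L\<close> - 1) / 2 for positive \<open>L\<close>; level 0 is never cut.\<close>

lemma sum_node_weight_below_root_le:
  "(\<Sum>l<L. \<Sum>j=1..2 ^ (L - l). \<bar>node_weight L k (j, l)\<bar>)
    \<le> (real L + 1) / 2 * of_bool (\<not> 2 ^ L dvd k)"
proof -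
  define u :: "nat \<Rightarrow> real" where "u l = of_bool (\<not> 2 ^ l dvd k)" for l
  have "(\<Sum>l<L. \<Sum>j=1..2 ^ (L - l). \<bar>node_weight L k (j, l)\<bar>) \<le> (\<Sum>l<L. u (Suc l) - u l / 2)"
    unfolding u_def by (intro sum_mono level_sum_node_weight_le) auto
  also have "(\<Sum>l<n. u (Suc l) - u l / 2) \<le> (real n + 1) / 2 * u n" for n
  proof (induction n)
    case (Suc n)
    have "u n \<le> u (Suc n)"
      by (auto simp: u_def dest: power_le_dvd)
    from mult_left_mono[OF this, of "real n / 2"] Suc show ?case
      by (simp add: field_simps)
  qed (simp add: u_def)
  finally show ?thesis
    by (simp add: u_def)
qed

text \<open>The triangle inequality is used only below the root. Each prefix that cuts the root adds
  at most (\<open>L\<close> + 1) / 2 there and lowers the root bound of 1 by 1/2, a net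
  \<open>L\<close> / 2.\<close>

lemma dyadic_interval_cost_le:
  assumes "p \<le> 2 ^ L" "q \<le> 2 ^ L"
  shows "(\<Sum>x\<in>noise_index L. \<bar>node_weight L q x - node_weight L p x\<bar>) \<le> real L + 1"
proof -
  define u :: "nat \<Rightarrow> real" where "u k = of_bool (\<not> 2 ^ L dvd k)" for k
  \<comment> \<open>These bounds force the root weight to be 1/2 if the root is cut and leave it in
    the unit interval otherwise.\<close>
  have "u k / 2 \<le> node_weight L k (1, L) \<and> node_weight L k (1, L) \<le> 1 - u k / 2"
    if "k \<le> 2 ^ L" for k
  proof (cases "k = 2 ^ L")
    case False
    then show ?thesis
      using that by (simp add: node_weight_def block_value_def u_def)
  qed (simp add: node_weight_def block_value_def u_def)
  from this[OF assms(1)] this[OF assms(2)]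
  have root: "\<bar>node_weight L q (1, L) - node_weight L p (1, L)\<bar> \<le> 1 - (u p + u q) / 2"
    by (auto simp: abs_real_def field_simps)
  have u_le: "u k \<le> 1" for k
    by (simp add: u_def)
  have below: "(\<Sum>l<L. \<Sum>j=1..2 ^ (L - l). \<bar>node_weight L q (j, l) - node_weight L p (j, l)\<bar>)
      \<le> (real L + 1) / 2 * (u q + u p)"
  proof -
    have "(\<Sum>l<L. \<Sum>j=1..2 ^ (L - l). \<bar>node_weight L q (j, l) - node_weight L p (j, l)\<bar>)
      \<le> (\<Sum>l<L. \<Sum>j=1..2 ^ (L - l). \<bar>node_weight L q (j, l)\<bar> + \<bar>node_weight L p (j, l)\<bar>)"
      by (intro sum_mono) auto
    then show ?thesis
      using sum_node_weight_below_root_le[of L p] sum_node_weight_below_root_le[of L q]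
      by (simp add: sum.distrib u_def distrib_left)
  qed
  have "(\<Sum>x\<in>noise_index L. \<bar>node_weight L q x - node_weight L p x\<bar>)
      \<le> (real L + 1) / 2 * (u q + u p) + (1 - (u p + u q) / 2)"
    using below root unfolding sum_noise_index atLeast0AtMost lessThan_Suc_atMost[symmetric]
    by simp
  also have "\<dots> = 1 + real L * ((u p + u q) / 2)"
    by (simp add: field_simps)
  also have "\<dots> \<le> real L + 1"
    using u_le[of p] u_le[of q] mult_left_mono[of "(u p + u q) / 2" 1 "real L"] by simp
  finally show ?thesis .
qed

section \<open>Privacy\<close>

text \<open>By independence the joint law of the noise is a product of Laplace laws, so a shift by
  \<open>s\<close> costs the product of the factors \<open>exp (\<bar>s i\<bar> / b)\<close>: only
  the 1-norm of \<open>s\<close> matters.\<close>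

lemma (in prob_space) laplace_noise_shift_le:
  fixes Y :: "'i \<Rightarrow> 'a \<Rightarrow> real"
  assumes "0 < b" "finite I" "I \<noteq> {}"
    and indep: "indep_vars (\<lambda>_. borel) Y I"
    and D: "\<And>i. i \<in> I \<Longrightarrow> distributed M lborel (Y i) (\<lambda>u. ennreal (laplace_density b u))"
    and T [measurable]: "T \<in> sets (Pi\<^sub>M I (\<lambda>_. borel))"
    and s: "(\<Sum>i\<in>I. \<bar>s i\<bar>) \<le> \<epsilon> * b"
  shows "prob {w \<in> space M. (\<lambda>i\<in>I. Y i w + s i) \<in> T}
    \<le> exp \<epsilon> * prob {w \<in> space M. (\<lambda>i\<in>I. Y i w) \<in> T}"
proof -
  define \<nu> where "\<nu> = density lborel (\<lambda>u. ennreal (laplace_density b u))"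
  define P where "P = Pi\<^sub>M I (\<lambda>_. \<nu>)"
  have \<nu>: "distr M borel (Y i) = \<nu>" if "i \<in> I" for i
    using distributed_distr_eq_density[OF D[OF that]]
    by (simp add: \<nu>_def cong: distr_cong)
  have [measurable]: "Y i \<in> borel_measurable M" if "i \<in> I" for i
    using distributed_measurable[OF D[OF that]] by simp
  have sets_\<nu> [measurable_cong]: "sets \<nu> = sets borel"
    by (simp add: \<nu>_def)
  have "prob_space \<nu>"
    using \<open>I \<noteq> {}\<close> \<nu> by (metis all_not_in_conv prob_space_distr \<open>\<And>i. i \<in> I \<Longrightarrow> Y i \<in> borel_measurable M\<close>)
  then have ps: "product_sigma_finite (\<lambda>_. \<nu>)"
    by (simp add: product_sigma_finite_def prob_space_imp_sigma_finite)
  have sets_P [measurable_cong]: "sets P = sets (Pi\<^sub>M I (\<lambda>_. borel))"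
    unfolding P_def by (intro sets_PiM_cong) (auto simp: sets_\<nu>)
  have distr_P: "distr M (Pi\<^sub>M I (\<lambda>_. borel)) (\<lambda>w. \<lambda>i\<in>I. Y i w) = P"
    using indep_vars_iff_distr_eq_PiM'[where I = I and X = Y and M' = "\<lambda>_. borel"] \<open>I \<noteq> {}\<close> indep
    by (auto simp: P_def \<nu> cong: PiM_cong)
  have shift: "emeasure M {w \<in> space M. (\<lambda>i\<in>I. Y i w + r i) \<in> T}
      = (\<integral>\<^sup>+h. indicator T (\<lambda>i\<in>I. h i + r i) \<partial>P)" for r :: "'i \<Rightarrow> real"
  proof -
    have [measurable]: "(\<lambda>h. \<lambda>i\<in>I. h i + r i) \<in> measurable (Pi\<^sub>M I (\<lambda>_. borel)) (Pi\<^sub>M I (\<lambda>_. borel))"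
      by measurable
    have "(\<integral>\<^sup>+h. indicator T (\<lambda>i\<in>I. h i + r i) \<partial>P)
        = (\<integral>\<^sup>+w. indicator T (\<lambda>i\<in>I. (\<lambda>i\<in>I. Y i w) i + r i) \<partial>M)"
      unfolding distr_P[symmetric] by (subst nn_integral_distr) auto
    also have "\<dots> = (\<integral>\<^sup>+w. indicator {w \<in> space M. (\<lambda>i\<in>I. Y i w + r i) \<in> T} w \<partial>M)"
      by (intro nn_integral_cong) (auto simp: indicator_def cong: restrict_cong)
    finally show ?thesis
      by simp
  qed
  have "emeasure M {w \<in> space M. (\<lambda>i\<in>I. Y i w + s i) \<in> T}
      = (\<integral>\<^sup>+h. indicator T (\<lambda>i\<in>I. h i + s i) \<partial>P)"
    by (rule shift)
  also have "\<dots> \<le> (\<Prod>i\<in>I. ennreal (exp (\<bar>s i\<bar> / b))) * (\<integral>\<^sup>+h. indicator T h \<partial>P)"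
    unfolding P_def
  proof (rule nn_integral_PiM_shift_le[OF ps \<open>finite I\<close> sets_\<nu>])
    show "(\<integral>\<^sup>+x. g (x + s i) \<partial>\<nu>) \<le> ennreal (exp (\<bar>s i\<bar> / b)) * (\<integral>\<^sup>+x. g x \<partial>\<nu>)"
      if "g \<in> borel_measurable borel" for i g
      unfolding \<nu>_def using \<open>0 < b\<close> that by (rule nn_integral_laplace_shift_le)
    show "(indicator T :: _ \<Rightarrow> ennreal) \<in> borel_measurable (Pi\<^sub>M I (\<lambda>_. \<nu>))"
      unfolding P_def[symmetric] by measurable
  qed
  also have "\<dots> \<le> ennreal (exp \<epsilon>) * (\<integral>\<^sup>+h. indicator T h \<partial>P)"
  proof (rule mult_right_mono)
    have "(\<Prod>i\<in>I. ennreal (exp (\<bar>s i\<bar> / b))) = ennreal (exp ((\<Sum>i\<in>I. \<bar>s i\<bar>) / b))"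
      using \<open>finite I\<close> by (simp add: prod_ennreal exp_sum sum_divide_distrib)
    also have "\<dots> \<le> ennreal (exp \<epsilon>)"
      using s \<open>0 < b\<close> by (intro ennreal_leI) (simp add: divide_le_eq)
    finally show "(\<Prod>i\<in>I. ennreal (exp (\<bar>s i\<bar> / b))) \<le> ennreal (exp \<epsilon>)" .
  qed simp
  also have "(\<integral>\<^sup>+h. indicator T h \<partial>P) = emeasure P T"
    by simp
  also have "emeasure P T = emeasure M {w \<in> space M. (\<lambda>i\<in>I. Y i w) \<in> T}"
    unfolding distr_P[symmetric] by (subst emeasure_distr) (auto intro!: arg_cong2[where f = emeasure])
  finally have "emeasure M {w \<in> space M. (\<lambda>i\<in>I. Y i w + s i) \<in> T}
      \<le> ennreal (exp \<epsilon>) * emeasure M {w \<in> space M. (\<lambda>i\<in>I. Y i w) \<in> T}" .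
  then show ?thesis
    by (simp add: emeasure_eq_measure flip: ennreal_mult)
qed

section \<open>The effect of replacing one instance\<close>

text \<open>The denominators agree and the counts differ only at the one position of disagreement.
  \<open>x\<close> and \<open>y\<close> are independent of \<open>t\<close>, so one noise shift can
  serve all evaluation points.\<close>

lemma empirical_cdf_adjacent:
  assumes "adjacent X1 X2"
  obtains x y where "\<And>t. empirical_cdf \<phi> X1 t
    = empirical_cdf \<phi> X2 t + (of_bool (\<phi> x \<le> t) - of_bool (\<phi> y \<le> t)) / real (length X2)"
proof -
  define n where "n = length X2"
  have n: "length X1 = n"
    using assms by (simp add: adjacent_def n_def)
  obtain m where m: "{k. k < n \<and> X1 ! k \<noteq> X2 ! k} = {m}"
    using assms by (auto simp: adjacent_def n card_1_singleton_iff)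
  then have "m < n" and same: "\<And>k. k < n \<Longrightarrow> k \<noteq> m \<Longrightarrow> X1 ! k = X2 ! k"
    by blast+
  have card: "real (card {k. k < n \<and> \<phi> (X ! k) \<le> t})
      = of_bool (\<phi> (X ! m) \<le> t) + (\<Sum>k\<in>{..<n} - {m}. of_bool (\<phi> (X ! k) \<le> t))" for X t
  proof -
    have "real (card {k. k < n \<and> \<phi> (X ! k) \<le> t}) = (\<Sum>k<n. of_bool (\<phi> (X ! k) \<le> t))"
      by (simp add: Int_def)
    also have "\<dots> = of_bool (\<phi> (X ! m) \<le> t) + (\<Sum>k\<in>{..<n} - {m}. of_bool (\<phi> (X ! k) \<le> t))"
      using \<open>m < n\<close> by (intro sum.remove) auto
    finally show ?thesis .
  qed
  have "empirical_cdf \<phi> X1 t = empirical_cdf \<phi> X2 t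
      + (of_bool (\<phi> (X1 ! m) \<le> t) - of_bool (\<phi> (X2 ! m) \<le> t)) / real (length X2)" for t
  proof -
    have "(\<Sum>k\<in>{..<n} - {m}. of_bool (\<phi> (X1 ! k) \<le> t))
        = (\<Sum>k\<in>{..<n} - {m}. of_bool (\<phi> (X2 ! k) \<le> t) :: real)"
      by (intro sum.cong) (auto simp: same)
    then show ?thesis
      by (simp add: empirical_cdf_def n n_def[symmetric] card add_divide_distrib diff_divide_distrib)
  qed
  then show thesis
    by (rule that)
qed

text \<open>Monotonicity makes the indices of the points below \<open>a\<close> a prefix
  \<open>{1..k}\<close>, the shape that the node weights handle.\<close>

lemma mono_on_le_iff_index:
  fixes \<tau> :: "nat \<Rightarrow> 'a::linorder"
  assumes "mono_on {1..N} \<tau>"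
  obtains k where "k \<le> N" and "\<And>i. i \<in> {1..N} \<Longrightarrow> a \<le> \<tau> i \<longleftrightarrow> k < i"
proof
  \<comment> \<open>The added 0 makes \<open>Max A\<close> meaningful, and equal to 0, when no point
    lies below \<open>a\<close>.\<close>
  define A where "A = insert 0 {i \<in> {1..N}. \<tau> i < a}"
  have A: "finite A" "A \<noteq> {}"
    by (auto simp: A_def)
  show "Max A \<le> N"
    using A by (auto simp: A_def)
  show "a \<le> \<tau> i \<longleftrightarrow> Max A < i" if i: "i \<in> {1..N}" for i
  proof
    assume "a \<le> \<tau> i"
    then have "j < i" if "j \<in> A" for j
      using that i mono_onD[OF assms, of i j] by (force simp: A_def not_le[symmetric])
    with A show "Max A < i"
      by simp
  next
    assume "Max A < i"
    then have "i \<notin> A"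
      using A Max_ge leD by blast
    with i show "a \<le> \<tau> i"
      by (auto simp: A_def not_less)
  qed
qed

section \<open>Privacy of the published values and their expected squared error\<close>

theorem theorem1:
  fixes \<epsilon> :: real and X :: "'x list" and \<phi> :: "'x \<Rightarrow> real"
    and N L :: nat and \<tau> :: "nat \<Rightarrow> real"
    and M :: "'w measure" and \<eta> :: "nat \<times> nat \<Rightarrow> 'w \<Rightarrow> real"
  assumes "\<epsilon> > 0"
    and "X \<noteq> []"
    and "N \<ge> 1"
    and "mono_on {1..N} \<tau>"
    and "\<tau> 1 = Min (\<phi> ` set X)"
    and "\<tau> N = Max (\<phi> ` set X)"
    and "L = nat \<lceil>log 2 (real N)\<rceil>"
    and "prob_space M"
    and "prob_space.indep_vars M (\<lambda>_. borel) \<eta> (noise_index L)"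
    and "\<And>p. p \<in> noise_index L \<Longrightarrow>
           distributed M lborel (\<eta> p) (\<lambda>u. ennreal (laplace_density ((real L + 1) / \<epsilon>) u))"
  shows "differentially_private M (\<Pi>\<^sub>M i\<in>{1..N}. borel) \<epsilon>
           (\<lambda>(X' :: 'x list) w. \<lambda>i\<in>{1..N}. noisy_cdf \<phi> \<tau> L \<eta> X' i w)
       \<and> (\<forall>i\<in>{1..N}.
            prob_space.expectation M
              (\<lambda>w. (empirical_cdf \<phi> X (\<tau> i) - noisy_cdf \<phi> \<tau> L \<eta> X i w)\<^sup>2)
            = (2 * (real L + 1) ^ 3 / \<epsilon>\<^sup>2) / (real (length X))\<^sup>2)"
proof -
  interpret prob_space M by fact
  define I where "I = noise_index L"
  define b where "b = (real L + 1) / \<epsilon>"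
  define node where "node i l = (Suc ((i - 1) div 2 ^ l), l)" for i l :: nat
  have "0 < b"
    using \<open>0 < \<epsilon>\<close> by (simp add: b_def)
  have indep: "indep_vars (\<lambda>_. borel) \<eta> I"
    and D: "\<And>p. p \<in> I \<Longrightarrow> distributed M lborel (\<eta> p) (\<lambda>u. ennreal (laplace_density b u))"
    using assms(9,10) by (auto simp: I_def b_def)
  have \<eta>_meas [measurable]: "\<eta> p \<in> borel_measurable M" if "p \<in> I" for p
    using distributed_measurable[OF D[OF that]] by simp
  \<comment> \<open>Thanks to the rounding up in \<open>L\<close>, all evaluation indices are leaves
    of the tree.\<close>
  have N_le: "N \<le> 2 ^ L"
  proof -
    have "log 2 (real N) \<le> real L"
      unfolding assms(7) by linarith
    then have "real N \<le> 2 ^ L"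
      using \<open>N \<ge> 1\<close> by (simp add: log_le_iff powr_realpow)
    then show ?thesis
      by (metis of_nat_le_iff of_nat_numeral of_nat_power)
  qed
  have node_in: "node i l \<in> I" if "i \<in> {1..N}" "l \<le> L" for i l
    using that N_le unfolding node_def I_def by (intro dyadic_in_noise_index) auto
  have noisy: "noisy_cdf \<phi> \<tau> L \<eta> X' i w
      = empirical_cdf \<phi> X' (\<tau> i) + 1 / real (length X') * (\<Sum>l=0..L. \<eta> (node i l) w)"
    if "i \<in> {1..N}" for X' i w
    using that by (simp add: noisy_cdf_def node_def nat_ceiling_div_pow2)

  have "differentially_private M (\<Pi>\<^sub>M i\<in>{1..N}. borel) \<epsilon>
      (\<lambda>X' w. \<lambda>i\<in>{1..N}. noisy_cdf \<phi> \<tau> L \<eta> X' i w)"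
    unfolding differentially_private_def
  proof (intro conjI allI impI ballI)
    fix X' :: "'x list"
    show "(\<lambda>w. \<lambda>i\<in>{1..N}. noisy_cdf \<phi> \<tau> L \<eta> X' i w) \<in> measurable M (\<Pi>\<^sub>M i\<in>{1..N}. borel)"
      using node_in by (intro measurable_restrict) (auto simp: noisy intro!: borel_measurable_add borel_measurable_times borel_measurable_sum)
  next
    fix X1 X2 :: "'x list" and S
    assume adj: "adjacent X1 X2" and S: "S \<in> sets (\<Pi>\<^sub>M i\<in>{1..N}. (borel :: real measure))"
    obtain x y where xy: "\<And>t. empirical_cdf \<phi> X1 t
        = empirical_cdf \<phi> X2 t + (of_bool (\<phi> x \<le> t) - of_bool (\<phi> y \<le> t)) / real (length X2)"
      using empirical_cdf_adjacent[OF adj] by blast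
    obtain p where p: "p \<le> N" "\<And>i. i \<in> {1..N} \<Longrightarrow> \<phi> x \<le> \<tau> i \<longleftrightarrow> p < i"
      using mono_on_le_iff_index[OF \<open>mono_on {1..N} \<tau>\<close>] by blast
    obtain q where q: "q \<le> N" "\<And>i. i \<in> {1..N} \<Longrightarrow> \<phi> y \<le> \<tau> i \<longleftrightarrow> q < i"
      using mono_on_le_iff_index[OF \<open>mono_on {1..N} \<tau>\<close>] by blast
    \<comment> \<open>The instance \<open>x\<close> counts at the indices outside the prefix
      \<open>{1..p}\<close>, and \<open>y\<close> outside \<open>{1..q}\<close>; passing to the
      prefixes therefore swaps the signs.\<close>
    define s where "s v = node_weight L q v - node_weight L p v" for v
    define out where "out h = (\<lambda>i\<in>{1..N}. empirical_cdf \<phi> X2 (\<tau> i)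
        + 1 / real (length X2) * (\<Sum>l=0..L. h (node i l)))" for h :: "nat \<times> nat \<Rightarrow> real"
    \<comment> \<open>The noise vectors that send \<open>X2\<close> into \<open>S\<close>. Both
      events of the privacy inequality become membership in \<open>T\<close>, for shifted and for
      unshifted noise.\<close>
    define T where "T = out -` S \<inter> space (Pi\<^sub>M I (\<lambda>_. borel))"
    have "out \<in> measurable (Pi\<^sub>M I (\<lambda>_. borel)) (\<Pi>\<^sub>M i\<in>{1..N}. borel)"
      unfolding out_def using node_in
      by (intro measurable_restrict borel_measurable_add borel_measurable_times borel_measurable_sum
           measurable_component_singleton) auto
    then have T: "T \<in> sets (Pi\<^sub>M I (\<lambda>_. borel))"
      unfolding T_def using S by (rule measurable_sets)
    \<comment> \<open>Noise \<eta> on \<open>X1\<close> publishes the same values as noise \<eta> +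
      \<open>s\<close> on \<open>X2\<close>, because the path sums of \<open>s\<close> are the
      differences of the counts.\<close>
    have out1: "(\<lambda>i\<in>{1..N}. noisy_cdf \<phi> \<tau> L \<eta> X1 i w) = out (\<lambda>v\<in>I. \<eta> v w + s v)" for w
    proof (unfold out_def, rule restrict_ext)
      fix i assume i: "i \<in> {1..N}"
      have "(\<Sum>l=0..L. s (node i l)) = of_bool (i \<le> q) - of_bool (i \<le> p)"
      proof -
        have "i \<noteq> 0"
          using i by simp
        then show ?thesis
          by (simp only: s_def node_def sum_subtractf sum_node_weight not_False_eq_True)
      qed
      also have "\<dots> = of_bool (\<phi> x \<le> \<tau> i) - of_bool (\<phi> y \<le> \<tau> i)"
        using p(2)[OF i] q(2)[OF i] by auto
      finally have s_sum: "(\<Sum>l=0..L. s (node i l)) = of_bool (\<phi> x \<le> \<tau> i) - of_bool (\<phi> y \<le> \<tau> i)" .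
      have "(\<Sum>l=0..L. (\<lambda>v\<in>I. \<eta> v w + s v) (node i l))
          = (\<Sum>l=0..L. \<eta> (node i l) w) + (of_bool (\<phi> x \<le> \<tau> i) - of_bool (\<phi> y \<le> \<tau> i))"
        using node_in[OF i] by (simp add: sum.distrib flip: s_sum)
      then show "noisy_cdf \<phi> \<tau> L \<eta> X1 i w = empirical_cdf \<phi> X2 (\<tau> i)
          + 1 / real (length X2) * (\<Sum>l=0..L. (\<lambda>v\<in>I. \<eta> v w + s v) (node i l))"
        using adj by (simp add: noisy[OF i] xy adjacent_def add_divide_distrib)
    qed
    have out2: "(\<lambda>i\<in>{1..N}. noisy_cdf \<phi> \<tau> L \<eta> X2 i w) = out (\<lambda>v\<in>I. \<eta> v w)" for w
      unfolding out_def using node_in by (intro restrict_ext) (simp add: noisy)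
    have "(\<Sum>v\<in>I. \<bar>s v\<bar>) \<le> real L + 1"
      unfolding s_def I_def using p(1) q(1) N_le by (intro dyadic_interval_cost_le) auto
    also have "\<dots> = \<epsilon> * b"
      using \<open>0 < \<epsilon>\<close> by (simp add: b_def)
    finally have "prob {w \<in> space M. (\<lambda>v\<in>I. \<eta> v w + s v) \<in> T}
        \<le> exp \<epsilon> * prob {w \<in> space M. (\<lambda>v\<in>I. \<eta> v w) \<in> T}"
      using node_in[of 1 0] \<open>N \<ge> 1\<close>
      by (intro laplace_noise_shift_le[OF \<open>0 < b\<close> _ _ indep D T]) (auto simp: I_def finite_noise_index)
    then show "prob {w \<in> space M. (\<lambda>i\<in>{1..N}. noisy_cdf \<phi> \<tau> L \<eta> X1 i w) \<in> S}
        \<le> exp \<epsilon> * prob {w \<in> space M. (\<lambda>i\<in>{1..N}. noisy_cdf \<phi> \<tau> L \<eta> X2 i w) \<in> S}"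
      unfolding out1 out2 T_def by (simp add: space_PiM)
  qed
  moreover have "expectation (\<lambda>w. (empirical_cdf \<phi> X (\<tau> i) - noisy_cdf \<phi> \<tau> L \<eta> X i w)\<^sup>2)
      = (2 * (real L + 1) ^ 3 / \<epsilon>\<^sup>2) / (real (length X))\<^sup>2" if i: "i \<in> {1..N}" for i
  proof -
    \<comment> \<open>The path of leaf \<open>i\<close>: its \<open>L + 1\<close> nodes are distinct
      because their levels are, so the noise is a sum over a set of independent variables.\<close>
    define J where "J = node i ` {0..L}"
    have J: "finite J" "J \<subseteq> I" "card J = Suc L" and inj: "inj_on (node i) {0..L}"
      using node_in[OF i] by (auto simp: J_def node_def inj_on_def card_image)
    \<comment> \<open>The noise sum is scaled by the reciprocal of the dataset size; squaring it
      yields the denominator of the claimed error.\<close>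
    have "(empirical_cdf \<phi> X (\<tau> i) - noisy_cdf \<phi> \<tau> L \<eta> X i w)\<^sup>2
        = (\<Sum>v\<in>J. \<eta> v w)\<^sup>2 / (real (length X))\<^sup>2" for w
      unfolding noisy[OF i] J_def sum.reindex[OF inj] by (simp add: power_divide)
    then have "expectation (\<lambda>w. (empirical_cdf \<phi> X (\<tau> i) - noisy_cdf \<phi> \<tau> L \<eta> X i w)\<^sup>2)
        = expectation (\<lambda>w. (\<Sum>v\<in>J. \<eta> v w)\<^sup>2) / (real (length X))\<^sup>2"
      by simp
    also have "expectation (\<lambda>w. (\<Sum>v\<in>J. \<eta> v w)\<^sup>2) = (\<Sum>v\<in>J. expectation (\<lambda>w. (\<eta> v w)\<^sup>2))"
      using indep_vars_sum_second_moment[OF J(1) indep_vars_subset[OF indep J(2)]]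
        laplace_distributed_moments[OF \<open>0 < b\<close> D] J(2)
      by blast
    also have "\<dots> = (\<Sum>v\<in>J. 2 * b\<^sup>2)"
      using laplace_distributed_moments(4)[OF \<open>0 < b\<close> D] J(2) by (intro sum.cong) auto
    also have "\<dots> = 2 * (real L + 1) ^ 3 / \<epsilon>\<^sup>2"
      using J(3) by (simp add: b_def power2_eq_square power3_eq_cube field_simps)
    finally show ?thesis .
  qed
  ultimately show ?thesis
    by blast
qed

end
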